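(* Let $a,b$ be axes in $A$ and assume $(a,b)=1$. Then: (1) If $b_0=0$, then $[L_a,L_b]$ is a derivation on $A$. (2) If $\mathrm{char}(\mathbb{F})\ne3$, then for all $x_{1/2},y_{1/2}\in A_{1/2}(a)$ and $y_0\in A_0(a)$ one has $$b_{1/2}(x_{1/2}y_{1/2})+(b_{1/2}x_{1/2})y_{1/2}+(b_{1/2}y_{1/2})x_{1/2}=\tfrac12(b,y_{1/2})x_{1/2}+\tfrac12(b,x_{1/2})y_{1/2}+(a,x_{1/2}y_{1/2})b_{1/2}$$ and $$\big(b_{1/2}(x_{1/2}y_0)\big)_0=(b_{1/2}x_{1/2})y_0-\big((b_{1/2}y_0)x_{1/2}\big)_0 .$$ In particular, $[L_a,L_b]$ is a derivation on $A$.
   Context: $\mathbb{F}$ is a field of characteristic not $2$ and $A$ is a commutative, not necessarily associative, $\mathbb{F}$-algebra equipped with a Frobenius form, i.e. a symmetric bilinear form $(\cdot,\cdot):A\times A\to\mathbb{F}$ with $(xy,z)=(x,yz)$ for all $x,y,z\in A$. For $z\in A$ and $\lambda\in\mathbb{F}$ put $A_\lambda(z)=\{x\in A: zx=\lambda x\}$. An axis is an idempotent $c\in A$ (so $c^2=c$) such that $(c,c)=1$, $A=\mathbb{F}c\oplus A_0(c)\oplus A_{1/2}(c)$, and the fusion rules hold: for $x_0,y_0\in A_0(c)$ and $x_{1/2},y_{1/2}\in A_{1/2}(c)$ one has $x_0y_0\in A_0(c)$, $x_0y_{1/2}\in A_{1/2}(c)$, $x_{1/2}y_{1/2}\in\mathbb{F}c+A_0(c)$.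 Given the axis $a$, each $x\in A$ is written uniquely $x=(a,x)a+x_0+x_{1/2}$ with $x_\lambda\in A_\lambda(a)$, $\lambda\in\{0,\frac12\}$; $(x)_0$ and $(x)_{1/2}$ also denote these components. In particular $b=(a,b)a+b_0+b_{1/2}$. For $x\in A$, $L_x(y)=xy$, and $[L_x,L_y]=L_xL_y-L_yL_x$. A derivation on $A$ is an $\mathbb{F}$-linear map $D:A\to A$ with $D(xy)=xD(y)+D(x)y$ for all $x,y\in A$. *)

theory Defs
  imports "HOL-Computational_Algebra.Computational_Algebra"
begin

text \<open>
  The library has no class of commutative, not necessarily associative algebras, so the algebra
  is an abelian group carrying a scalar multiplication \<open>sc\<close>, a product \<open>m\<close> and a form \<open>B\<close>.
  Both \<open>m\<close> and \<open>B\<close> are symmetric, so linearity in the second argument gives bilinearity.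
\<close>

locale frobenius_algebra = vector_space sc
  for sc :: "'f::field \<Rightarrow> 'a::ab_group_add \<Rightarrow> 'a" +
  fixes m :: "'a \<Rightarrow> 'a \<Rightarrow> 'a"
    and B :: "'a \<Rightarrow> 'a \<Rightarrow> 'f"
  assumes char_not_2: "CHAR('f) \<noteq> 2"
    and mult_commute: "m x y = m y x"
    and mult_linear: "Vector_Spaces.linear sc sc (m x)"
    and form_sym: "B x y = B y x"
    and form_linear: "Vector_Spaces.linear sc (*) (B x)"
    and form_assoc: "B (m x y) z = B x (m y z)"

definition eigenspace ::
  "('f::field \<Rightarrow> 'a::ab_group_add \<Rightarrow> 'a) \<Rightarrow> ('a \<Rightarrow> 'a \<Rightarrow> 'a) \<Rightarrow> 'a \<Rightarrow> 'f \<Rightarrow> 'a set"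
  where "eigenspace sc m z l = {x. m z x = sc l x}"

definition is_axis ::
  "('f::field \<Rightarrow> 'a::ab_group_add \<Rightarrow> 'a) \<Rightarrow> ('a \<Rightarrow> 'a \<Rightarrow> 'a) \<Rightarrow> ('a \<Rightarrow> 'a \<Rightarrow> 'f) \<Rightarrow> 'a \<Rightarrow> bool"
  where "is_axis sc m B c \<longleftrightarrow>
    m c c = c \<and> B c c = 1 \<and>
    (\<forall>x. \<exists>!(u, v, w). u \<in> range (\<lambda>t. sc t c) \<and> v \<in> eigenspace sc m c 0 \<and>
       w \<in> eigenspace sc m c (1/2) \<and> x = u + v + w) \<and>
    (\<forall>x \<in> eigenspace sc m c 0. \<forall>y \<in> eigenspace sc m c 0. m x y \<in> eigenspace sc m c 0) \<and>
    (\<forall>x \<in> eigenspace sc m c 0. \<forall>y \<in> eigenspace sc m c (1/2).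
       m x y \<in> eigenspace sc m c (1/2)) \<and>
    (\<forall>x \<in> eigenspace sc m c (1/2). \<forall>y \<in> eigenspace sc m c (1/2).
       \<exists>t. \<exists>v \<in> eigenspace sc m c 0. m x y = sc t c + v)"

text \<open>
  The components of \<open>x\<close> in \<open>x = (a,x)a + x\<^sub>0 + x\<^sub>1\<^sub>/\<^sub>2\<close>. They are meaningful only when \<open>a\<close> is an
  axis; existence and uniqueness are proved in \<open>axis_decomposition\<close> below.
\<close>

definition comp_zero ::
  "('f::field \<Rightarrow> 'a::ab_group_add \<Rightarrow> 'a) \<Rightarrow> ('a \<Rightarrow> 'a \<Rightarrow> 'a) \<Rightarrow> ('a \<Rightarrow> 'a \<Rightarrow> 'f) \<Rightarrow> 'a \<Rightarrow> 'a \<Rightarrow> 'a"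
  where "comp_zero sc m B a x =
    (THE v. v \<in> eigenspace sc m a 0 \<and>
       (\<exists>w \<in> eigenspace sc m a (1/2). x = sc (B a x) a + v + w))"

definition comp_half ::
  "('f::field \<Rightarrow> 'a::ab_group_add \<Rightarrow> 'a) \<Rightarrow> ('a \<Rightarrow> 'a \<Rightarrow> 'a) \<Rightarrow> ('a \<Rightarrow> 'a \<Rightarrow> 'f) \<Rightarrow> 'a \<Rightarrow> 'a \<Rightarrow> 'a"
  where "comp_half sc m B a x =
    (THE w. w \<in> eigenspace sc m a (1/2) \<and>
       (\<exists>v \<in> eigenspace sc m a 0. x = sc (B a x) a + v + w))"

definition commutator :: "('a::ab_group_add \<Rightarrow> 'a) \<Rightarrow> ('a \<Rightarrow> 'a) \<Rightarrow> 'a \<Rightarrow> 'a"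
  where "commutator f g = (\<lambda>x. f (g x) - g (f x))"

definition is_derivation ::
  "('f::field \<Rightarrow> 'a::ab_group_add \<Rightarrow> 'a) \<Rightarrow> ('a \<Rightarrow> 'a \<Rightarrow> 'a) \<Rightarrow> ('a \<Rightarrow> 'a) \<Rightarrow> bool"
  where "is_derivation sc m D \<longleftrightarrow>
    Vector_Spaces.linear sc sc D \<and> (\<forall>x y. D (m x y) = m x (D y) + m (D x) y)"

context frobenius_algebra
begin

lemma form_right:
  "B x (y + z) = B x y + B x z" "B x (sc t y) = t * B x y"
  using form_linear[of x] by (auto simp: Vector_Spaces.linear_def module_hom_def module_hom_axioms_def)

lemma two_neq_0: "(2::'f) \<noteq> 0"
proof
  assume h: "(2::'f) = 0"
  hence "of_nat 2 = (0::'f)" by simp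
  hence "CHAR('f) dvd 2" by (simp only: of_nat_eq_0_iff_char_dvd)
  hence "CHAR('f) = 1 \<or> CHAR('f) = 2"
    by (metis prime_nat_iff two_is_prime_nat)
  with char_not_2 show False by simp
qed

lemma form_eigenvector:
  assumes "m c c = c" "v \<in> eigenspace sc m c l" "l \<noteq> 1"
  shows "B c v = 0"
proof -
  have "B c v = B (m c c) v" using assms by simp
  also have "\<dots> = B c (m c v)" by (rule form_assoc)
  also have "\<dots> = l * B c v" using assms by (simp add: eigenspace_def form_right)
  finally have "(1 - l) * B c v = 0" by (simp add: algebra_simps)
  thus ?thesis using assms(3) by simp
qed

lemma axis_decomposition:
  assumes "is_axis sc m B a"
  shows "comp_zero sc m B a x \<in> eigenspace sc m a 0"
    and "comp_half sc m B a x \<in> eigenspace sc m a (1/2)"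
    and "x = sc (B a x) a + comp_zero sc m B a x + comp_half sc m B a x"
    and "\<lbrakk>v \<in> eigenspace sc m a 0; w \<in> eigenspace sc m a (1/2); x = sc t a + v + w\<rbrakk>
      \<Longrightarrow> t = B a x \<and> v = comp_zero sc m B a x \<and> w = comp_half sc m B a x"
proof -
  let ?P = "\<lambda>u v w. u \<in> range (\<lambda>t. sc t a) \<and> v \<in> eigenspace sc m a 0 \<and>
       w \<in> eigenspace sc m a (1/2) \<and> x = u + v + w"
  have idem: "m a a = a" and len: "B a a = 1" and ex: "\<exists>!(u, v, w). ?P u v w"
    using assms unfolding is_axis_def by auto
  have half: "(1/2::'f) \<noteq> 1"
  proof
    assume "(1/2::'f) = 1"
    hence "(1::'f) = 2" using two_neq_0 by (simp add: field_simps)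
    hence "(1::'f) + 0 = 1 + 1" by (simp only: one_add_one add_0_right)
    thus False by (simp only: add_left_cancel zero_neq_one)
  qed
  have coeff: "t = B a x" if "v \<in> eigenspace sc m a 0" "w \<in> eigenspace sc m a (1/2)"
    "x = sc t a + v + w" for t v w
    using form_eigenvector[OF idem that(1)] form_eigenvector[OF idem that(2) half] that(3) len
    by (simp add: form_right)
  obtain p where p: "case p of (u, v, w) \<Rightarrow> ?P u v w"
    and p_uniq: "\<And>q. (case q of (u, v, w) \<Rightarrow> ?P u v w) \<Longrightarrow> q = p"
    using ex by (rule ex1E) blast
  obtain u v w where puvw: "p = (u, v, w)" by (cases p)
  have P: "?P u v w" using p unfolding puvw prod.case .
  have uniq: "u' = u \<and> v' = v \<and> w' = w" if "?P u' v' w'" for u' v' w'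
    using p_uniq[of "(u', v', w')"] that unfolding puvw prod.case prod.inject by blast
  obtain t where t: "u = sc t a" using P by auto
  have V: "v \<in> eigenspace sc m a 0" and W: "w \<in> eigenspace sc m a (1/2)"
    and X: "x = sc t a + v + w"
    using P unfolding t by blast+
  have tt: "t = B a x" by (rule coeff[OF V W X])
  have X': "x = sc (B a x) a + v + w" using X unfolding tt .
  have un: "v' = v \<and> w' = w" if "v' \<in> eigenspace sc m a 0" "w' \<in> eigenspace sc m a (1/2)"
    "x = sc (B a x) a + v' + w'" for v' w'
    using uniq[of "sc (B a x) a" v' w'] that by blast
  have z: "comp_zero sc m B a x = v" unfolding comp_zero_def
    by (rule the_equality) (use V W X' un in blast)+
  have h: "comp_half sc m B a x = w" unfolding comp_half_def
    by (rule the_equality) (use V W X' un in blast)+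
  show "comp_zero sc m B a x \<in> eigenspace sc m a 0"
    "comp_half sc m B a x \<in> eigenspace sc m a (1/2)"
    "x = sc (B a x) a + comp_zero sc m B a x + comp_half sc m B a x"
    unfolding z h by (fact V, fact W, fact X')
  show "t = B a x \<and> v = comp_zero sc m B a x \<and> w = comp_half sc m B a x"
    if "v \<in> eigenspace sc m a 0" "w \<in> eigenspace sc m a (1/2)" "x = sc t a + v + w" for v w t
    using coeff[OF that] un[OF that(1,2)] that(3) z h by blast
qed

end

end

theory Submission
  imports Defs
begin

text \<open>
  Write \<open>b = a + z + h\<close> with \<open>z = b\<^sub>0\<close> and \<open>h = b\<^sub>1\<^sub>/\<^sub>2\<close>. Idempotency of \<open>b\<close> and its fusion rules force
  \<open>h\<^sup>2 = z\<close>, \<open>zh = 0\<close> and \<open>z\<^sup>2 = 0\<close>, so \<open>z\<close> lies in \<open>A\<^sub>0(a) \<inter> A\<^sub>0(b)\<close> and \<open>L\<^sub>z\<close> commutes with \<open>L\<^sub>a\<close> and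
  \<open>L\<^sub>b\<close>, hence with \<open>L\<^sub>h\<close>. The fusion rules of an axis \<open>c\<close> say that the Miyamoto involution
  \<open>x \<mapsto> x - 4cx + 4(c,x)c\<close> is multiplicative. Applying the involutions of \<open>a\<close> and \<open>b\<close> to each other
  shows the same for the elements \<open>a + sh + s\<^sup>2z\<close> with \<open>s = \<plusminus>1, \<plusminus>2\<close>. The part of the
  multiplicativity relation that is odd in \<open>s\<close> has the form \<open>8s(s\<^sup>2R - L) = 0\<close>, where \<open>L = 0\<close> is the wanted
  identity and \<open>R\<close> vanishes if \<open>z = 0\<close>. If \<open>z \<noteq> 0\<close>, comparing \<open>s = 1\<close> with \<open>s = 2\<close>
  gives \<open>3L = 0\<close>, which is where characteristic \<open>3\<close> is excluded.
\<close>

section \<open>Reduction of vector identities to scalar identities\<close>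

context vector_space
begin

text \<open>
  Identities between vectors are reduced to commutative ring identities, on which the method
  \<open>algebra\<close> works, by applying an arbitrary linear functional.
\<close>

lemma vector_eqI:
  assumes "\<And>f. Vector_Spaces.linear scale ((*) :: 'a \<Rightarrow> 'a \<Rightarrow> 'a) f \<Longrightarrow> f x = f y"
  shows "x = y"
proof (rule ccontr)
  assume "x \<noteq> y"
  interpret vp: vector_space_pair scale "(*) :: 'a \<Rightarrow> 'a \<Rightarrow> 'a"
    by unfold_locales (auto simp: algebra_simps)
  have "independent {x - y}" using \<open>x \<noteq> y\<close> by simp
  then obtain f where f: "Vector_Spaces.linear scale ((*) :: 'a \<Rightarrow> 'a \<Rightarrow> 'a) f" "f (x - y) = 1"
    using vp.linear_independent_extend[of "{x - y}" "\<lambda>_. 1"] by auto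
  interpret f: Vector_Spaces.linear scale "(*) :: 'a \<Rightarrow> 'a \<Rightarrow> 'a" f by (fact f(1))
  show False using assms[OF f(1)] f(2) by (simp add: f.diff)
qed

end

text \<open>A named constant instead of a quotient, so that \<open>algebra\<close> treats it as an
  indeterminate governed by the relation \<open>two_half\<close>.\<close>

definition half :: "'f::field" where "half = 1/2"

section \<open>Bilinearity, eigenspaces and fusion rules of one axis\<close>

context frobenius_algebra
begin

notation m (infixl "\<bullet>" 70)
notation sc (infixr "\<odot>" 75)

lemma mult_right: "x \<bullet> (y + z) = x \<bullet> y + x \<bullet> z" "x \<bullet> (y - z) = x \<bullet> y - x \<bullet> z"
  "x \<bullet> (- y) = - (x \<bullet> y)" "x \<bullet> 0 = 0" "x \<bullet> (t \<odot> y) = t \<odot> (x \<bullet> y)"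
proof -
  interpret l: Vector_Spaces.linear sc sc "m x" by (rule mult_linear)
  show "x \<bullet> (y + z) = x \<bullet> y + x \<bullet> z" "x \<bullet> (y - z) = x \<bullet> y - x \<bullet> z"
  "x \<bullet> (- y) = - (x \<bullet> y)" "x \<bullet> 0 = 0" "x \<bullet> (t \<odot> y) = t \<odot> (x \<bullet> y)"
    by (rule l.add l.diff l.neg l.zero l.scale)+
qed

lemma mult_left: "(y + z) \<bullet> x = y \<bullet> x + z \<bullet> x" "(y - z) \<bullet> x = y \<bullet> x - z \<bullet> x"
  "(- y) \<bullet> x = - (y \<bullet> x)" "0 \<bullet> x = 0" "(t \<odot> y) \<bullet> x = t \<odot> (y \<bullet> x)"
  using mult_right by (simp_all add: mult_commute[of _ x])

lemma form_linear_simps: "B x (y + z) = B x y + B x z" "B x (y - z) = B x y - B x z"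
  "B x (- y) = - B x y" "B x 0 = 0" "B x (t \<odot> y) = t * B x y"
proof -
  interpret l: Vector_Spaces.linear sc "(*)" "B x" by (rule form_linear)
  show "B x (y + z) = B x y + B x z" "B x (y - z) = B x y - B x z"
  "B x (- y) = - B x y" "B x 0 = 0" "B x (t \<odot> y) = t * B x y"
    by (rule l.add l.diff l.neg l.zero l.scale)+
qed

lemma form_left: "B (y + z) x = B y x + B z x" "B (y - z) x = B y x - B z x"
  "B (- y) x = - B y x" "B 0 x = 0" "B (t \<odot> y) x = t * B y x"
  using form_linear_simps by (simp_all add: form_sym[of _ x])

lemma functional_simps:
  assumes "Vector_Spaces.linear sc ((*) :: 'f \<Rightarrow> 'f \<Rightarrow> 'f) f"
  shows "f (x + y) = f x + f y" "f (x - y) = f x - f y" "f (- x) = - f x" "f 0 = 0"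
    "f (t \<odot> x) = t * f x"
proof -
  interpret l: Vector_Spaces.linear sc "(*)" f by (rule assms)
  show "f (x + y) = f x + f y" "f (x - y) = f x - f y" "f (- x) = - f x" "f 0 = 0"
    "f (t \<odot> x) = t * f x"
    by (rule l.add l.diff l.neg l.zero l.scale)+
qed

lemmas bilinear = mult_right mult_left form_linear_simps form_left

lemma two_half: "2 * half = (1::'f)"
  using two_neq_0 by (simp add: half_def)

lemma half_neq_1: "half \<noteq> (1::'f)"
proof
  assume "half = (1::'f)"
  then have "(1::'f) + 1 = 1 + 0" using two_half by simp
  then show False by (simp only: add_left_cancel one_neq_zero)
qed

lemma half_neq_0: "half \<noteq> (0::'f)"
  using two_half by auto

abbreviation E0 where "E0 c \<equiv> eigenspace sc m c 0"
abbreviation Eh where "Eh c \<equiv> eigenspace sc m c (1/2)"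

lemma E0_iff: "u \<in> E0 c \<longleftrightarrow> c \<bullet> u = 0"
  by (simp add: eigenspace_def)

lemma Eh_iff: "x \<in> Eh c \<longleftrightarrow> c \<bullet> x = half \<odot> x"
  by (simp add: eigenspace_def half_def)

lemma eigenspace_closed:
  assumes "x \<in> eigenspace sc m c l" "y \<in> eigenspace sc m c l"
  shows "x + y \<in> eigenspace sc m c l" "x - y \<in> eigenspace sc m c l"
    "- x \<in> eigenspace sc m c l"
    "t \<odot> x \<in> eigenspace sc m c l" "0 \<in> eigenspace sc m c l"
  using assms by (simp_all add: eigenspace_def mult_right scale_right_distrib
      scale_right_diff_distrib mult.commute)

lemma axis_mult: "is_axis sc m B c \<Longrightarrow> c \<bullet> c = c"
  and axis_form: "is_axis sc m B c \<Longrightarrow> B c c = 1"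
  and fusion_00: "is_axis sc m B c \<Longrightarrow> u \<in> E0 c \<Longrightarrow> v \<in> E0 c \<Longrightarrow> u \<bullet> v \<in> E0 c"
  and fusion_0h: "is_axis sc m B c \<Longrightarrow> u \<in> E0 c \<Longrightarrow> x \<in> Eh c \<Longrightarrow> u \<bullet> x \<in> Eh c"
  and fusion_hh: "is_axis sc m B c \<Longrightarrow> x \<in> Eh c \<Longrightarrow> y \<in> Eh c \<Longrightarrow> \<exists>t. \<exists>v\<in>E0 c. x \<bullet> y = t \<odot> c + v"
  by (simp_all add: is_axis_def)

lemma fusion_h0: "is_axis sc m B c \<Longrightarrow> u \<in> E0 c \<Longrightarrow> x \<in> Eh c \<Longrightarrow> x \<bullet> u \<in> Eh c"
  using fusion_0h mult_commute by metis

lemma axis_form_0: "is_axis sc m B c \<Longrightarrow> u \<in> E0 c \<Longrightarrow> B c u = 0"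
  by (rule form_eigenvector[of _ _ 0]) (simp_all add: axis_mult)

lemma axis_form_half: "is_axis sc m B c \<Longrightarrow> x \<in> Eh c \<Longrightarrow> B c x = 0"
  using half_neq_1 by (intro form_eigenvector[of _ _ "1/2"]) (simp_all add: axis_mult half_def)

lemma axis_cases:
  assumes "is_axis sc m B c"
  obtains t u w where "u \<in> E0 c" "w \<in> Eh c" "x = t \<odot> c + u + w"
  using axis_decomposition[OF assms] by metis

section \<open>Miyamoto involutions\<close>

text \<open>For an axis \<open>c\<close> this fixes the span of \<open>c\<close> and
  \<open>E0 c\<close> and negates \<open>Eh c\<close>. The polynomial formula makes sense for every
  \<open>c\<close>, so it also applies to elements not known to be axes.\<close>

definition miyamoto where "miyamoto c x = x - 4 \<odot> (c \<bullet> x) + (4 * B c x) \<odot> c"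

lemma miyamoto_decomp:
  assumes "is_axis sc m B c" "u \<in> E0 c" "w \<in> Eh c"
  shows "miyamoto c (t \<odot> c + u + w) = t \<odot> c + u - w"
proof (rule vector_eqI)
  fix f assume f: "Vector_Spaces.linear sc ((*) :: 'f \<Rightarrow> 'f \<Rightarrow> 'f) f"
  have [simp]: "c \<bullet> u = 0" "c \<bullet> w = half \<odot> w" "B c u = 0" "B c w = 0" "B c c = 1" "c \<bullet> c = c"
    using assms by (auto simp: axis_form_0 axis_form_half axis_form axis_mult E0_iff Eh_iff)
  show "f (miyamoto c (t \<odot> c + u + w)) = f (t \<odot> c + u - w)"
    unfolding miyamoto_def bilinear \<open>c \<bullet> u = 0\<close> \<open>c \<bullet> w = half \<odot> w\<close> \<open>B c u = 0\<close> \<open>B c w = 0\<close>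
      \<open>B c c = 1\<close> \<open>c \<bullet> c = c\<close> functional_simps[OF f]
    using two_half by algebra
qed

text \<open>The operator sending \<open>x\<close> to
  \<open>2 \<odot> (c \<bullet> (c \<bullet> x)) - c \<bullet> x\<close> kills \<open>E0 c\<close>
  and \<open>Eh c\<close> and fixes \<open>c\<close>, so it is the projection to the line of
  \<open>c\<close>. For the axis \<open>b\<close> it will be split along the eigenspaces of
  \<open>a\<close>.\<close>

lemma axis_quadratic:
  assumes "is_axis sc m B c"
  shows "2 \<odot> (c \<bullet> (c \<bullet> x)) = c \<bullet> x + B c x \<odot> c"
proof (rule vector_eqI)
  fix f assume f: "Vector_Spaces.linear sc ((*) :: 'f \<Rightarrow> 'f \<Rightarrow> 'f) f"
  obtain t u w where *: "u \<in> E0 c" "w \<in> Eh c" "x = t \<odot> c + u + w"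
    using axis_cases[OF assms] .
  have r: "c \<bullet> u = 0" "c \<bullet> w = half \<odot> w" "B c u = 0" "B c w = 0" "B c c = 1" "c \<bullet> c = c"
    using assms * by (auto simp: axis_form_0 axis_form_half axis_form axis_mult E0_iff Eh_iff)
  show "f (2 \<odot> (c \<bullet> (c \<bullet> x))) = f (c \<bullet> x + B c x \<odot> c)"
    unfolding *(3) bilinear r functional_simps[OF f]
    using two_half by algebra
qed

definition multiplicative where "multiplicative g \<longleftrightarrow> (\<forall>x y. g (x \<bullet> y) = g x \<bullet> g y)"

text \<open>The fusion rules are a grading modulo 2 with odd part \<open>Eh c\<close>, and the
  involution changes the sign of the odd part.\<close>

lemma miyamoto_multiplicative:
  assumes c: "is_axis sc m B c"
  shows "multiplicative (miyamoto c)"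
  unfolding multiplicative_def
proof (intro allI)
  fix x y
  obtain s u w where x: "u \<in> E0 c" "w \<in> Eh c" "x = s \<odot> c + u + w"
    using axis_cases[OF assms] .
  obtain s' u' w' where y: "u' \<in> E0 c" "w' \<in> Eh c" "y = s' \<odot> c + u' + w'"
    using axis_cases[OF assms] .
  obtain t v where v: "v \<in> E0 c" "w \<bullet> w' = t \<odot> c + v"
    using fusion_hh[OF c x(2) y(2)] by auto
  have r: "c \<bullet> u = 0" "c \<bullet> w = half \<odot> w" "u \<bullet> c = 0" "w \<bullet> c = half \<odot> w"
    "c \<bullet> u' = 0" "c \<bullet> w' = half \<odot> w'" "c \<bullet> c = c"
    using assms x y mult_commute[of u c] mult_commute[of w c]
    by (simp_all add: axis_mult E0_iff Eh_iff)
  \<comment> \<open>The first two summands are the even part of the product, the last one is the odd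
    part.\<close>
  have xy: "x \<bullet> y = (s * s' + t) \<odot> c + (u \<bullet> u' + v)
      + ((s * half) \<odot> w' + (s' * half) \<odot> w + u \<bullet> w' + w \<bullet> u')" (is "_ = ?p + ?q + ?r")
  proof (rule vector_eqI)
    fix f assume f: "Vector_Spaces.linear sc ((*) :: 'f \<Rightarrow> 'f \<Rightarrow> 'f) f"
    show "f (x \<bullet> y) = f (?p + ?q + ?r)"
      unfolding x(3) y(3) bilinear r v(2) functional_simps[OF f] by algebra
  qed
  have "miyamoto c (x \<bullet> y) = ?p + ?q - ?r"
    unfolding xy using c x y v(1)
    by (intro miyamoto_decomp eigenspace_closed fusion_00[OF c x(1) y(1)]
        fusion_0h[OF c x(1) y(2)] fusion_h0[OF c y(1) x(2)])
  also have "\<dots> = (s \<odot> c + u - w) \<bullet> (s' \<odot> c + u' - w')"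
  proof (rule vector_eqI)
    fix f assume f: "Vector_Spaces.linear sc ((*) :: 'f \<Rightarrow> 'f \<Rightarrow> 'f) f"
    show "f (?p + ?q - ?r) = f ((s \<odot> c + u - w) \<bullet> (s' \<odot> c + u' - w'))"
      unfolding bilinear r v(2) functional_simps[OF f] by algebra
  qed
  also have "\<dots> = miyamoto c x \<bullet> miyamoto c y"
    unfolding x(3) y(3) using c x y by (simp add: miyamoto_decomp)
  finally show "miyamoto c (x \<bullet> y) = miyamoto c x \<bullet> miyamoto c y" .
qed

lemma miyamoto_involution:
  assumes "is_axis sc m B c"
  shows "miyamoto c (miyamoto c x) = x"
proof -
  obtain s u w where x: "u \<in> E0 c" "w \<in> Eh c" "x = s \<odot> c + u + w"
    using axis_cases[OF assms] .
  have "s \<odot> c + u - w = s \<odot> c + u + (- w)" by simp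
  then have "miyamoto c (s \<odot> c + u - w) = s \<odot> c + u - (- w)"
    using x assms by (metis miyamoto_decomp eigenspace_closed(3))
  then show ?thesis using x assms by (simp add: miyamoto_decomp)
qed

lemma miyamoto_selfadjoint: "B (miyamoto c x) y = B x (miyamoto c y)"
  using form_assoc[of x c y] mult_commute[of c x] form_sym[of x c]
  by (simp add: miyamoto_def bilinear)

lemma miyamoto_linear: "Vector_Spaces.linear sc sc (miyamoto c)"
  by unfold_locales
    (simp_all add: miyamoto_def bilinear algebra_simps scale_left_distrib scale_right_distrib
      scale_right_diff_distrib)

text \<open>The involution of \<open>e\<close> respects the product and, being self-adjoint of order
  dividing 2, the form. Conjugation by it therefore carries the formula for \<open>c\<close> to the
  formula for the image of \<open>c\<close>.\<close>

lemma miyamoto_conjugate: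
  assumes e: "is_axis sc m B e" and c: "multiplicative (miyamoto c)"
  shows "multiplicative (miyamoto (miyamoto e c))"
proof -
  interpret e: Vector_Spaces.linear sc sc "miyamoto e" by (rule miyamoto_linear)
  note mu = miyamoto_multiplicative[OF e, unfolded multiplicative_def, rule_format]
  have "miyamoto (miyamoto e c) x = miyamoto e (miyamoto c (miyamoto e x))" for x
    unfolding miyamoto_def[of c] e.add e.diff e.scale mu miyamoto_involution[OF e]
    by (simp add: miyamoto_def[of "miyamoto e c"] miyamoto_selfadjoint)
  then show ?thesis using mu c by (simp add: multiplicative_def)
qed

section \<open>Eigenvectors: orthogonality, uniqueness of components, products\<close>

lemma E0_orthogonal_Eh:
  assumes "u \<in> E0 c" "x \<in> Eh c"
  shows "B u x = 0" "B x u = 0"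
proof -
  have "half * B u x = B u (c \<bullet> x)" using assms by (simp add: Eh_iff bilinear)
  also have "\<dots> = 0" using assms form_assoc[of u c x] mult_commute[of u c]
    by (simp add: E0_iff bilinear)
  finally show "B u x = 0" using half_neq_0 by simp
  then show "B x u = 0" by (simp add: form_sym)
qed

lemma axis_components_unique:
  assumes "is_axis sc m B c" "u \<in> E0 c" "x \<in> Eh c" "v \<in> E0 c" "y \<in> Eh c"
    "s \<odot> c + u + x = t \<odot> c + v + y"
  shows "s = t" "u = v" "x = y"
  using axis_decomposition(4)[OF assms(1), of u x "s \<odot> c + u + x" s]
    axis_decomposition(4)[OF assms(1), of v y "s \<odot> c + u + x" t] assms by auto

lemma axis_components_zero:
  assumes "is_axis sc m B c" "u \<in> E0 c" "x \<in> Eh c" "s \<odot> c + u + x = 0"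
  shows "s = 0" "u = 0" "x = 0"
proof -
  have "0 \<in> E0 c" "0 \<in> Eh c" using assms eigenspace_closed(5) by blast+
  moreover have "s \<odot> c + u + x = 0 \<odot> c + 0 + 0" using assms(4) by simp
  ultimately show "s = 0" "u = 0" "x = 0"
    using axis_components_unique[OF assms(1-3)] by blast+
qed

text \<open>For \<open>x\<close> and \<open>y\<close> in \<open>Eh c\<close> this is the component
  of the product in \<open>E0 c\<close>: the coefficient of \<open>c\<close> is
  \<open>B c (x \<bullet> y) = B (c \<bullet> x) y = half * B x y\<close>.\<close>

definition half_prod_zero where "half_prod_zero c x y = x \<bullet> y - (half * B x y) \<odot> c"

lemma half_prod_zero_in_E0:
  assumes "is_axis sc m B c" "x \<in> Eh c" "y \<in> Eh c"
  shows "half_prod_zero c x y \<in> E0 c"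
proof -
  obtain t v where v: "v \<in> E0 c" "x \<bullet> y = t \<odot> c + v" using fusion_hh[OF assms] by auto
  have "t = B c (x \<bullet> y)" using v assms by (simp add: bilinear axis_form axis_form_0)
  also have "\<dots> = half * B x y" using form_assoc[of c x y] assms by (simp add: Eh_iff bilinear)
  finally show ?thesis using v by (simp add: half_prod_zero_def)
qed

lemma half_prod: "x \<bullet> y = (half * B x y) \<odot> c + half_prod_zero c x y"
  by (simp add: half_prod_zero_def)

text \<open>Multiplication by \<open>u\<close> kills \<open>c\<close> and maps each of
  \<open>E0 c\<close> and \<open>Eh c\<close> into itself.\<close>

lemma E0_mult_commutes_axis:
  assumes "is_axis sc m B c" "u \<in> E0 c"
  shows "c \<bullet> (u \<bullet> x) = u \<bullet> (c \<bullet> x)"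
proof -
  obtain t v w where x: "v \<in> E0 c" "w \<in> Eh c" "x = t \<odot> c + v + w"
    using axis_cases[OF assms(1)] .
  show ?thesis using fusion_00[OF assms x(1)] fusion_0h[OF assms x(2)] assms x
    mult_commute[of u c] by (simp add: bilinear E0_iff Eh_iff axis_mult)
qed

end

section \<open>Components of the second axis\<close>

text \<open>The coefficient of \<open>a\<close> in \<open>b\<close> is \<open>B a b\<close>, so
  \<open>b_eq\<close> encodes the assumption that this value is 1.\<close>

locale axis_pair = frobenius_algebra sc m B
  for sc :: "'f::field \<Rightarrow> 'a::ab_group_add \<Rightarrow> 'a" and m B +
  fixes a b z h :: 'a
  assumes a: "is_axis sc m B a" and b: "is_axis sc m B b"
    and z: "z \<in> eigenspace sc m a 0" and h: "h \<in> eigenspace sc m a (1/2)"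
    and b_eq: "b = a + z + h"
begin

notation m (infixl "\<bullet>" 70)
notation sc (infixr "\<odot>" 75)

lemma aa: "a \<bullet> a = a" "B a a = 1" using axis_mult axis_form a by auto

lemma a_E0: "u \<in> E0 a \<Longrightarrow> a \<bullet> u = 0" "u \<in> E0 a \<Longrightarrow> u \<bullet> a = 0"
  using mult_commute[of u a] by (auto simp: E0_iff)

lemma a_Eh: "x \<in> Eh a \<Longrightarrow> a \<bullet> x = half \<odot> x" "x \<in> Eh a \<Longrightarrow> x \<bullet> a = half \<odot> x"
  using mult_commute[of x a] by (auto simp: Eh_iff)

lemma ha: "a \<bullet> h = half \<odot> h" "h \<bullet> a = half \<odot> h" using a_Eh h by auto

lemma za: "a \<bullet> z = 0" "z \<bullet> a = 0" using a_E0 z by auto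

text \<open>These are the three components of \<open>b \<bullet> b - b = 0\<close> along
  \<open>a\<close>. The linear half part \<open>2 \<odot> (a \<bullet> h) - h\<close> cancels,
  leaving \<open>2 \<odot> (z \<bullet> h)\<close>.\<close>

lemma idempotent_components:
  shows h_isotropic: "B h h = 0" and z_h: "z \<bullet> h = 0" and h_h': "h \<bullet> h = z - z \<bullet> z"
proof -
  have "(half * B h h) \<odot> a + (z \<bullet> z + half_prod_zero a h h - z) + 2 \<odot> (z \<bullet> h) = 0"
  proof (rule vector_eqI)
    fix f assume f: "Vector_Spaces.linear sc ((*) :: 'f \<Rightarrow> 'f \<Rightarrow> 'f) f"
    have "f ((half * B h h) \<odot> a + (z \<bullet> z + half_prod_zero a h h - z) + 2 \<odot> (z \<bullet> h)) = f (b \<bullet> b - b)"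
      unfolding b_eq bilinear ha za aa half_prod_zero_def mult_commute[of h z] functional_simps[OF f]
      using two_half by algebra
    then show "f ((half * B h h) \<odot> a + (z \<bullet> z + half_prod_zero a h h - z) + 2 \<odot> (z \<bullet> h)) = f 0"
      by (simp add: axis_mult b)
  qed
  note c = axis_components_zero[OF a _ _ this]
  have m: "z \<bullet> z + half_prod_zero a h h - z \<in> E0 a" "2 \<odot> (z \<bullet> h) \<in> Eh a"
    using a z h by (auto intro!: eigenspace_closed fusion_00 half_prod_zero_in_E0 fusion_0h)
  show 1: "B h h = 0" using c(1)[OF m] half_neq_0 by simp
  show "z \<bullet> h = 0" using c(3)[OF m] two_neq_0 by simp
  show "h \<bullet> h = z - z \<bullet> z" using c(2)[OF m] by (simp add: half_prod_zero_def 1 algebra_simps)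
qed

lemma h_z: "h \<bullet> z = 0" using z_h mult_commute by simp

lemma forms: "B a z = 0" "B a h = 0" "B z h = 0" "B h z = 0" "B z a = 0" "B h a = 0"
  using axis_form_0[OF a z] axis_form_half[OF a h] E0_orthogonal_Eh[OF z h]
  by (simp_all add: form_sym)

text \<open>The components of \<open>b\<close> are orthogonal, hence
  \<open>1 = B b b = 1 + B z z + B h h\<close>.\<close>

lemma z_isotropic: "B z z = 0"
  using axis_form[OF b] by (simp add: b_eq bilinear forms aa h_isotropic)

abbreviation p where "p x \<equiv> half_prod_zero a h x"

lemma form_b_E0: "u \<in> E0 a \<Longrightarrow> B b u = B z u"
  by (simp add: b_eq bilinear axis_form_0[OF a] E0_orthogonal_Eh(2)[OF _ h])

lemma form_b_Eh: "x \<in> Eh a \<Longrightarrow> B b x = B h x"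
  by (simp add: b_eq bilinear axis_form_half[OF a] E0_orthogonal_Eh(1)[OF z])

text \<open>The relation \<open>axis_quadratic\<close> for \<open>b\<close> at \<open>u\<close>,
  read off in the three components along \<open>a\<close>.\<close>

lemma quadratic_E0:
  assumes u: "u \<in> E0 a"
  shows "B h (h \<bullet> u) = B z u"
    and "2 \<odot> (z \<bullet> (z \<bullet> u)) + 2 \<odot> p (h \<bullet> u) = z \<bullet> u + B z u \<odot> z"
    and "2 \<odot> (z \<bullet> (h \<bullet> u)) + 2 \<odot> (h \<bullet> (z \<bullet> u)) = B z u \<odot> h"
proof -
  have m: "z \<bullet> u \<in> E0 a" "h \<bullet> u \<in> Eh a" "z \<bullet> (z \<bullet> u) \<in> E0 a" "z \<bullet> (h \<bullet> u) \<in> Eh a"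
    "h \<bullet> (z \<bullet> u) \<in> Eh a" "p (h \<bullet> u) \<in> E0 a"
    using u z h a by (simp_all add: fusion_00 fusion_0h fusion_h0 half_prod_zero_in_E0)
  have "(B h (h \<bullet> u) - B z u) \<odot> a + (2 \<odot> (z \<bullet> (z \<bullet> u)) + 2 \<odot> p (h \<bullet> u) - (z \<bullet> u + B z u \<odot> z))
     + (2 \<odot> (z \<bullet> (h \<bullet> u)) + 2 \<odot> (h \<bullet> (z \<bullet> u)) - B z u \<odot> h) = 0" (is "?e = 0")
  proof (rule vector_eqI)
    fix f assume f: "Vector_Spaces.linear sc ((*) :: 'f \<Rightarrow> 'f \<Rightarrow> 'f) f"
    have "f ?e = f (2 \<odot> (b \<bullet> (b \<bullet> u)) - (b \<bullet> u + B b u \<odot> b))"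
      unfolding form_b_E0[OF u] unfolding b_eq bilinear a_E0[OF u] a_E0[OF m(1)] a_Eh[OF m(2)]
        half_prod_zero_def functional_simps[OF f]
      using two_half by algebra
    then show "f ?e = f 0" by (simp add: axis_quadratic b)
  qed
  note c = axis_components_zero[OF a _ _ this]
  have m': "2 \<odot> (z \<bullet> (z \<bullet> u)) + 2 \<odot> p (h \<bullet> u) - (z \<bullet> u + B z u \<odot> z) \<in> E0 a"
    "2 \<odot> (z \<bullet> (h \<bullet> u)) + 2 \<odot> (h \<bullet> (z \<bullet> u)) - B z u \<odot> h \<in> Eh a"
    using m z h by (auto intro!: eigenspace_closed)
  show "B h (h \<bullet> u) = B z u"
    and "2 \<odot> (z \<bullet> (z \<bullet> u)) + 2 \<odot> p (h \<bullet> u) = z \<bullet> u + B z u \<odot> z"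
    and "2 \<odot> (z \<bullet> (h \<bullet> u)) + 2 \<odot> (h \<bullet> (z \<bullet> u)) = B z u \<odot> h"
    using c[OF m'] by simp_all
qed

text \<open>
  With \<open>w = z\<^sup>2\<close> one finds \<open>w \<in> A\<^sub>1\<^sub>/\<^sub>2(b)\<close> and \<open>y = z - 2w \<in> A\<^sub>0(b)\<close>. The fusion rules of \<open>b\<close> give first
  \<open>w\<^sup>2 = 0\<close> and then \<open>y\<^sup>2 = -w \<in> A\<^sub>0(b)\<close>, so that \<open>w = 0\<close>.
\<close>

lemma z_z: "z \<bullet> z = 0"
proof -
  let ?w = "z \<bullet> z"
  \<comment> \<open>Pairing \<open>h \<bullet> h = z - ?w\<close> with \<open>u\<close> gives
    \<open>B h (h \<bullet> u) = B z u\<close>, so \<open>?w\<close> is orthogonal to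
    \<open>E0 a\<close>, which contains it.\<close>
  have "B ?w u = 0" if u: "u \<in> E0 a" for u
    using quadratic_E0(1)[OF u] form_assoc[of h h u] by (simp add: h_h' bilinear)
  then have ww: "B ?w ?w = 0" using a z fusion_00 by blast
  have "2 \<odot> (z \<bullet> ?w) = ?w"
    using quadratic_E0(2)[OF z] by (simp add: h_z bilinear half_prod_zero_def z_isotropic)
  then have zw: "z \<bullet> ?w = half \<odot> ?w"
    by (metis scale_scale mult.commute two_half scale_one)
  have hw: "h \<bullet> ?w = 0"
    using quadratic_E0(3)[OF z] two_neq_0 by (simp add: h_z bilinear z_isotropic)
  have aw: "a \<bullet> ?w = 0" using a z fusion_00 a_E0 by blast
  have wb: "?w \<in> Eh b" by (simp add: Eh_iff b_eq mult_left aw zw hw)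
  let ?y = "z - 2 \<odot> ?w"
  have yb: "?y \<in> E0 b" using two_half
    by (simp add: E0_iff b_eq bilinear aw zw hw za h_z)
  have "half_prod_zero b ?w ?w \<in> E0 b" using wb b half_prod_zero_in_E0 by blast
  then have ww0: "?w \<bullet> ?w \<in> E0 b" by (simp add: half_prod_zero_def ww)
  \<comment> \<open>Since \<open>?y \<bullet> ?w = half \<odot> ?w - 2 \<odot> (?w \<bullet>
    ?w)\<close>, the square of \<open>?w\<close> also lies in \<open>Eh b\<close>, which meets
    \<open>E0 b\<close> only in 0.\<close>
  have "half \<odot> (half \<odot> ?w - ?y \<bullet> ?w) \<in> Eh b"
    using fusion_0h[OF b yb wb] wb eigenspace_closed(2,4) by meson
  moreover have "half \<odot> (half \<odot> ?w - ?y \<bullet> ?w) = ?w \<bullet> ?w"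
    using two_half by (simp add: bilinear zw mult.commute)
  ultimately have "?w \<bullet> ?w \<in> Eh b" by simp
  with ww0 have www: "?w \<bullet> ?w = 0" using half_neq_0 by (simp add: E0_iff Eh_iff)
  have "?y \<bullet> ?y \<in> E0 b" using yb b fusion_00 by blast
  moreover have "?y \<bullet> ?y = - ?w"
  proof (rule vector_eqI)
    fix f assume f: "Vector_Spaces.linear sc ((*) :: 'f \<Rightarrow> 'f \<Rightarrow> 'f) f"
    show "f (?y \<bullet> ?y) = f (- ?w)"
      unfolding bilinear zw www mult_commute[of ?w z] functional_simps[OF f]
      using two_half by algebra
  qed
  ultimately have "- ?w \<in> E0 b" by simp
  then show "?w = 0" using wb half_neq_0 by (simp add: E0_iff Eh_iff mult_right)
qed

lemma h_h: "h \<bullet> h = z" by (simp add: h_h' z_z)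

lemma z_E0_b: "z \<in> E0 b" by (simp add: E0_iff b_eq mult_left z_z h_z za)

section \<open>Repeated products with \<open>z\<close> and \<open>h\<close>\<close>

lemma z_h_commute: "h \<bullet> (z \<bullet> x) = z \<bullet> (h \<bullet> x)"
  using E0_mult_commutes_axis[OF b z_E0_b, of x] E0_mult_commutes_axis[OF a z, of x]
  by (simp add: b_eq bilinear)

text \<open>The analogue of \<open>quadratic_E0\<close> for the other eigenspace. The second claim
  is the half component with \<open>p x\<close> rewritten through \<open>h \<bullet> x\<close>; its
  last term is removed only by \<open>z_z_Eh\<close>.\<close>

lemma quadratic_Eh:
  assumes x: "x \<in> Eh a"
  shows "2 \<odot> (z \<bullet> p x) + 2 \<odot> p (z \<bullet> x) = B h x \<odot> z"
    and "h \<bullet> (h \<bullet> x) = (half * B h x) \<odot> h - half \<odot> (z \<bullet> x) - z \<bullet> (z \<bullet> x)"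
proof -
  have m: "z \<bullet> x \<in> Eh a" "z \<bullet> (z \<bullet> x) \<in> Eh a" "p x \<in> E0 a" "z \<bullet> p x \<in> E0 a"
    "h \<bullet> p x \<in> Eh a" "p (z \<bullet> x) \<in> E0 a"
    using x z h a by (simp_all add: fusion_00 fusion_0h fusion_h0 half_prod_zero_in_E0)
  have zx: "B h (z \<bullet> x) = 0"
    using form_assoc[of h z x] by (simp add: h_z bilinear)
  have ax: "a \<bullet> (h \<bullet> x) = (half * B h x) \<odot> a"
    unfolding half_prod[of h x a] bilinear a_E0[OF m(3)] aa by simp
  let ?v = "2 \<odot> (z \<bullet> p x) + 2 \<odot> p (z \<bullet> x) - B h x \<odot> z"
  let ?y = "2 \<odot> (h \<bullet> p x) - ((half * B h x) \<odot> h - z \<bullet> x - 2 \<odot> (z \<bullet> (z \<bullet> x)))"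
  have "0 \<odot> a + ?v + ?y = 0"
  proof (rule vector_eqI)
    fix f assume f: "Vector_Spaces.linear sc ((*) :: 'f \<Rightarrow> 'f \<Rightarrow> 'f) f"
    have "f (0 \<odot> a + ?v + ?y) = f (2 \<odot> (b \<bullet> (b \<bullet> x)) - (b \<bullet> x + B b x \<odot> b))"
      unfolding form_b_Eh[OF x] unfolding b_eq bilinear a_Eh[OF x] a_Eh[OF m(1)] ax za ha zx
        half_prod_zero_def functional_simps[OF f]
      using two_half by algebra
    then show "f (0 \<odot> a + ?v + ?y) = f 0" by (simp add: axis_quadratic b)
  qed
  note c = axis_components_zero[OF a _ _ this]
  have m': "?v \<in> E0 a" "?y \<in> Eh a"
    using m z h by (auto intro!: eigenspace_closed)
  show "2 \<odot> (z \<bullet> p x) + 2 \<odot> p (z \<bullet> x) = B h x \<odot> z" using c(2)[OF m'] by simp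
  show "h \<bullet> (h \<bullet> x) = (half * B h x) \<odot> h - half \<odot> (z \<bullet> x) - z \<bullet> (z \<bullet> x)"
  proof (rule vector_eqI)
    fix f assume f: "Vector_Spaces.linear sc ((*) :: 'f \<Rightarrow> 'f \<Rightarrow> 'f) f"
    have "f (h \<bullet> (h \<bullet> x)) = f ((half * B h x) \<odot> h - half \<odot> (z \<bullet> x) - z \<bullet> (z \<bullet> x) + half \<odot> ?y)"
      unfolding half_prod_zero_def bilinear ha functional_simps[OF f]
      using two_half by algebra
    then show "f (h \<bullet> (h \<bullet> x)) = f ((half * B h x) \<odot> h - half \<odot> (z \<bullet> x) - z \<bullet> (z \<bullet> x))"
      using c(3)[OF m'] by simp
  qed
qed

text \<open>By \<open>z_h_commute\<close> the two summands in the third part of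
  \<open>quadratic_E0\<close> coincide, so each product is a quarter of the right side.\<close>

lemma z_h_E0:
  assumes u: "u \<in> E0 a"
  shows "z \<bullet> (h \<bullet> u) = (half * half * B z u) \<odot> h" "h \<bullet> (z \<bullet> u) = (half * half * B z u) \<odot> h"
proof -
  show "z \<bullet> (h \<bullet> u) = (half * half * B z u) \<odot> h"
  proof (rule vector_eqI)
    fix f assume f: "Vector_Spaces.linear sc ((*) :: 'f \<Rightarrow> 'f \<Rightarrow> 'f) f"
    have "f (2 \<odot> (z \<bullet> (h \<bullet> u)) + 2 \<odot> (h \<bullet> (z \<bullet> u))) = f (B z u \<odot> h)"
      using quadratic_E0(3)[OF u] by simp
    then show "f (z \<bullet> (h \<bullet> u)) = f ((half * half * B z u) \<odot> h)"
      unfolding z_h_commute functional_simps[OF f] using two_half by algebra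
  qed
  then show "h \<bullet> (z \<bullet> u) = (half * half * B z u) \<odot> h" by (simp add: z_h_commute)
qed

text \<open>As \<open>z \<bullet> a = 0\<close> and \<open>B h (z \<bullet> x) = 0\<close>, both
  uses of \<open>p\<close> in \<open>quadratic_Eh\<close> become plain products, which coincide by
  \<open>z_h_commute\<close>.\<close>

lemma z_h_Eh:
  assumes x: "x \<in> Eh a"
  shows "z \<bullet> (h \<bullet> x) = (half * half * B h x) \<odot> z" "h \<bullet> (z \<bullet> x) = (half * half * B h x) \<odot> z"
proof -
  have zx: "B h (z \<bullet> x) = 0"
    using form_assoc[of h z x] by (simp add: h_z bilinear)
  show "z \<bullet> (h \<bullet> x) = (half * half * B h x) \<odot> z"
  proof (rule vector_eqI)
    fix f assume f: "Vector_Spaces.linear sc ((*) :: 'f \<Rightarrow> 'f \<Rightarrow> 'f) f"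
    have "f (2 \<odot> (z \<bullet> p x) + 2 \<odot> p (z \<bullet> x)) = f (B h x \<odot> z)"
      using quadratic_Eh(1)[OF x] by simp
    then show "f (z \<bullet> (h \<bullet> x)) = f ((half * half * B h x) \<odot> z)"
      unfolding half_prod_zero_def bilinear zx za z_h_commute functional_simps[OF f]
      using two_half by algebra
  qed
  then show "h \<bullet> (z \<bullet> x) = (half * half * B h x) \<odot> z" by (simp add: z_h_commute)
qed

lemma miyamoto_b_a: "miyamoto b a = a + 2 \<odot> h + 4 \<odot> z"
proof (rule vector_eqI)
  fix f assume f: "Vector_Spaces.linear sc ((*) :: 'f \<Rightarrow> 'f \<Rightarrow> 'f) f"
  show "f (miyamoto b a) = f (a + 2 \<odot> h + 4 \<odot> z)"
    unfolding miyamoto_def b_eq bilinear aa ha za forms functional_simps[OF f]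
    using two_half by algebra
qed

text \<open>The quadratic relation leaves this product undetermined. The involution of
  \<open>b\<close> is multiplicative on \<open>a \<bullet> x = half \<odot> x\<close>, and the
  resulting relation collapses to 8 times the product.\<close>

lemma z_z_Eh:
  assumes x: "x \<in> Eh a"
  shows "z \<bullet> (z \<bullet> x) = 0"
proof -
  have m: "z \<bullet> x \<in> Eh a" "p x \<in> E0 a"
    using x z h a by (simp_all add: fusion_00 fusion_0h fusion_h0 half_prod_zero_in_E0)
  have ax: "a \<bullet> (h \<bullet> x) = (half * B h x) \<odot> a"
    unfolding half_prod[of h x a] bilinear a_E0[OF m(2)] aa by simp
  have "8 \<odot> (z \<bullet> (z \<bullet> x)) = 0"
  proof (rule vector_eqI)
    fix f assume f: "Vector_Spaces.linear sc ((*) :: 'f \<Rightarrow> 'f \<Rightarrow> 'f) f"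
    have "f (8 \<odot> (z \<bullet> (z \<bullet> x))) = f (half \<odot> miyamoto b x - miyamoto b a \<bullet> miyamoto b x)"
      unfolding miyamoto_b_a
      unfolding miyamoto_def form_b_Eh[OF x]
      unfolding b_eq bilinear a_Eh[OF x] a_Eh[OF m(1)] ax za ha aa z_z h_h z_h h_z z_h_Eh[OF x]
        quadratic_Eh(2)[OF x] functional_simps[OF f]
      using two_half by algebra
    also have "half \<odot> miyamoto b x = miyamoto b (a \<bullet> x)"
      unfolding a_Eh[OF x]
      by (simp add: miyamoto_def bilinear scale_right_distrib scale_right_diff_distrib)
        (simp add: algebra_simps)
    also have "\<dots> = miyamoto b a \<bullet> miyamoto b x"
      using miyamoto_multiplicative[OF b] by (simp add: multiplicative_def)
    finally show "f (8 \<odot> (z \<bullet> (z \<bullet> x))) = f 0" by simp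
  qed
  moreover have "(8::'f) = 2 * 2 * 2" by simp
  ultimately show ?thesis using two_neq_0 by (metis mult_eq_0_iff scale_eq_0_iff)
qed

text \<open>As in \<open>z_z_Eh\<close>, but starting from \<open>a \<bullet> u = 0\<close>, so the
  images of \<open>a\<close> and \<open>u\<close> under the involution of \<open>b\<close> have
  product 0. This also settles \<open>h \<bullet> (h \<bullet> u)\<close>, which \<open>hhu\<close>
  expresses through \<open>z \<bullet> (z \<bullet> u)\<close>.\<close>

lemma z_z_E0:
  assumes u: "u \<in> E0 a"
  shows "z \<bullet> (z \<bullet> u) = (half * B z u) \<odot> z"
    and "h \<bullet> (h \<bullet> u) = (half * B z u) \<odot> a + half \<odot> (z \<bullet> u)"
proof -
  have m: "z \<bullet> u \<in> E0 a" "h \<bullet> u \<in> Eh a"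
    using u z h a by (simp_all add: fusion_00 fusion_0h fusion_h0)
  have hhu: "h \<bullet> (h \<bullet> u) = (half * B z u) \<odot> a + half \<odot> (z \<bullet> u + B z u \<odot> z) - z \<bullet> (z \<bullet> u)"
  proof (rule vector_eqI)
    fix f assume f: "Vector_Spaces.linear sc ((*) :: 'f \<Rightarrow> 'f \<Rightarrow> 'f) f"
    have "f (h \<bullet> (h \<bullet> u)) = f ((half * B z u) \<odot> a + half \<odot> (2 \<odot> (z \<bullet> (z \<bullet> u)) + 2 \<odot> p (h \<bullet> u)) - z \<bullet> (z \<bullet> u))"
      unfolding half_prod_zero_def quadratic_E0(1)[OF u] functional_simps[OF f]
      using two_half by algebra
    then show "f (h \<bullet> (h \<bullet> u)) = f ((half * B z u) \<odot> a + half \<odot> (z \<bullet> u + B z u \<odot> z) - z \<bullet> (z \<bullet> u))"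
      using quadratic_E0(2)[OF u] by simp
  qed
  have "8 \<odot> (z \<bullet> (z \<bullet> u) - (half * B z u) \<odot> z) = 0" (is "?e = 0")
  proof (rule vector_eqI)
    fix f assume f: "Vector_Spaces.linear sc ((*) :: 'f \<Rightarrow> 'f \<Rightarrow> 'f) f"
    have "f ?e = f (- (miyamoto b a \<bullet> miyamoto b u))"
      unfolding miyamoto_b_a
      unfolding miyamoto_def form_b_E0[OF u]
      unfolding b_eq bilinear a_E0[OF u] a_E0[OF m(1)] a_Eh[OF m(2)] za ha aa z_z h_h z_h h_z
        z_h_E0[OF u] hhu functional_simps[OF f]
      using two_half by algebra
    also have "miyamoto b a \<bullet> miyamoto b u = miyamoto b (a \<bullet> u)"
      using miyamoto_multiplicative[OF b] by (simp add: multiplicative_def)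
    also have "f (- \<dots>) = f 0" using u by (simp add: E0_iff miyamoto_def bilinear)
    finally show "f ?e = f 0" .
  qed
  moreover have "(8::'f) = 2 * 2 * 2" by simp
  ultimately have "z \<bullet> (z \<bullet> u) - (half * B z u) \<odot> z = 0"
    using two_neq_0 by (metis mult_eq_0_iff scale_eq_0_iff)
  then show 1: "z \<bullet> (z \<bullet> u) = (half * B z u) \<odot> z" by simp
  show "h \<bullet> (h \<bullet> u) = (half * B z u) \<odot> a + half \<odot> (z \<bullet> u)"
    unfolding hhu 1 by (simp add: scale_right_distrib)
qed

section \<open>The curve through the axes and its odd multiplicativity defect\<close>

text \<open>The parameters 0, 1 and 2 give \<open>a\<close>, \<open>b\<close> and the image of
  \<open>a\<close> under the involution of \<open>b\<close>; the involution of \<open>a\<close>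
  changes the sign of the parameter.\<close>

definition axis_curve where "axis_curve s = a + s \<odot> h + (s * s) \<odot> z"

lemma miyamoto_a_axis_curve: "miyamoto a (axis_curve s) = axis_curve (- s)"
proof -
  have "axis_curve s = 1 \<odot> a + (s * s) \<odot> z + s \<odot> h" by (simp add: axis_curve_def)
  then have "miyamoto a (axis_curve s) = 1 \<odot> a + (s * s) \<odot> z - s \<odot> h"
    using miyamoto_decomp[OF a, of "(s * s) \<odot> z" "s \<odot> h" 1] z h eigenspace_closed(4) by metis
  then show ?thesis by (simp add: axis_curve_def)
qed

lemma axis_curve_multiplicative:
  assumes "s \<in> {1, 2}"
  shows "multiplicative (miyamoto (axis_curve s))" "multiplicative (miyamoto (axis_curve (- s)))"
proof -
  have "axis_curve 1 = b" "axis_curve 2 = miyamoto b a"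
    by (simp_all add: axis_curve_def b_eq miyamoto_b_a[unfolded b_eq])
  then show 1: "multiplicative (miyamoto (axis_curve s))"
    using assms miyamoto_multiplicative[OF b] miyamoto_conjugate[OF b miyamoto_multiplicative[OF a]]
    by auto
  show "multiplicative (miyamoto (axis_curve (- s)))"
    using miyamoto_conjugate[OF a 1] by (simp add: miyamoto_a_axis_curve)
qed

text \<open>Subtracting the defect at \<open>- s\<close> from the one at \<open>s\<close> cancels
  all even powers of \<open>s\<close>.\<close>

definition odd_defect where
  "odd_defect s x y = (miyamoto (axis_curve s) (x \<bullet> y) - miyamoto (axis_curve s) x \<bullet> miyamoto (axis_curve s) y)
    - (miyamoto (axis_curve (- s)) (x \<bullet> y) - miyamoto (axis_curve (- s)) x \<bullet> miyamoto (axis_curve (- s)) y)"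

lemma odd_defect: "s \<in> {1, 2} \<Longrightarrow> odd_defect s x y = 0"
  using axis_curve_multiplicative[of s] by (auto simp: odd_defect_def multiplicative_def)

text \<open>A multiplication table against \<open>a\<close>, \<open>h\<close> and \<open>z\<close>.
  Products occur in both orders so that unfolding normalizes them without a looping commutativity
  rule.\<close>

lemma E0_products:
  assumes u: "u \<in> E0 a"
  shows "a \<bullet> u = 0" "u \<bullet> a = 0" "u \<bullet> h = h \<bullet> u" "u \<bullet> z = z \<bullet> u"
    "a \<bullet> (h \<bullet> u) = half \<odot> (h \<bullet> u)" "a \<bullet> (z \<bullet> u) = 0"
    "(h \<bullet> u) \<bullet> a = half \<odot> (h \<bullet> u)" "(z \<bullet> u) \<bullet> a = 0"
    "h \<bullet> (h \<bullet> u) = (half * B z u) \<odot> a + half \<odot> (z \<bullet> u)"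
    "(h \<bullet> u) \<bullet> h = (half * B z u) \<odot> a + half \<odot> (z \<bullet> u)"
    "z \<bullet> (h \<bullet> u) = (half * half * B z u) \<odot> h" "(h \<bullet> u) \<bullet> z = (half * half * B z u) \<odot> h"
    "h \<bullet> (z \<bullet> u) = (half * half * B z u) \<odot> h" "(z \<bullet> u) \<bullet> h = (half * half * B z u) \<odot> h"
    "z \<bullet> (z \<bullet> u) = (half * B z u) \<odot> z" "(z \<bullet> u) \<bullet> z = (half * B z u) \<odot> z"
    "B a u = 0" "B h u = 0"
proof -
  note m = fusion_h0[OF a u h] fusion_00[OF a z u]
  note rules = a_E0[OF u] a_Eh[OF m(1)] a_E0[OF m(2)] z_z_E0[OF u] z_h_E0[OF u]
  show "a \<bullet> u = 0" "u \<bullet> a = 0" "u \<bullet> h = h \<bullet> u" "u \<bullet> z = z \<bullet> u"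
    "a \<bullet> (h \<bullet> u) = half \<odot> (h \<bullet> u)" "a \<bullet> (z \<bullet> u) = 0"
    "(h \<bullet> u) \<bullet> a = half \<odot> (h \<bullet> u)" "(z \<bullet> u) \<bullet> a = 0"
    "h \<bullet> (h \<bullet> u) = (half * B z u) \<odot> a + half \<odot> (z \<bullet> u)"
    "z \<bullet> (h \<bullet> u) = (half * half * B z u) \<odot> h"
    "h \<bullet> (z \<bullet> u) = (half * half * B z u) \<odot> h"
    "z \<bullet> (z \<bullet> u) = (half * B z u) \<odot> z"
    using rules mult_commute by auto
  then show "(h \<bullet> u) \<bullet> h = (half * B z u) \<odot> a + half \<odot> (z \<bullet> u)"
    "(h \<bullet> u) \<bullet> z = (half * half * B z u) \<odot> h"
    "(z \<bullet> u) \<bullet> h = (half * half * B z u) \<odot> h" "(z \<bullet> u) \<bullet> z = (half * B z u) \<odot> z"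
    using mult_commute by metis+
  show "B a u = 0" "B h u = 0" using axis_form_0[OF a u] E0_orthogonal_Eh[OF u h] by auto
qed

lemma Eh_products:
  assumes x: "x \<in> Eh a"
  shows "a \<bullet> x = half \<odot> x" "x \<bullet> a = half \<odot> x" "x \<bullet> h = h \<bullet> x" "x \<bullet> z = z \<bullet> x"
    "a \<bullet> (h \<bullet> x) = (half * B h x) \<odot> a" "a \<bullet> (z \<bullet> x) = half \<odot> (z \<bullet> x)"
    "(h \<bullet> x) \<bullet> a = (half * B h x) \<odot> a" "(z \<bullet> x) \<bullet> a = half \<odot> (z \<bullet> x)"
    "h \<bullet> (h \<bullet> x) = (half * B h x) \<odot> h - half \<odot> (z \<bullet> x)"
    "(h \<bullet> x) \<bullet> h = (half * B h x) \<odot> h - half \<odot> (z \<bullet> x)"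
    "z \<bullet> (h \<bullet> x) = (half * half * B h x) \<odot> z" "(h \<bullet> x) \<bullet> z = (half * half * B h x) \<odot> z"
    "h \<bullet> (z \<bullet> x) = (half * half * B h x) \<odot> z" "(z \<bullet> x) \<bullet> h = (half * half * B h x) \<odot> z"
    "z \<bullet> (z \<bullet> x) = 0" "(z \<bullet> x) \<bullet> z = 0"
    "B a x = 0" "B z x = 0"
proof -
  note m = fusion_0h[OF a z x] half_prod_zero_in_E0[OF a h x]
  have "a \<bullet> (h \<bullet> x) = (half * B h x) \<odot> a"
    unfolding half_prod[of h x a] bilinear a_E0[OF m(2)] aa by simp
  note rules = this a_Eh[OF x] a_Eh[OF m(1)] z_z_Eh[OF x] z_h_Eh[OF x] quadratic_Eh(2)[OF x]
  show "a \<bullet> x = half \<odot> x" "x \<bullet> a = half \<odot> x" "x \<bullet> h = h \<bullet> x" "x \<bullet> z = z \<bullet> x"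
    "a \<bullet> (h \<bullet> x) = (half * B h x) \<odot> a" "a \<bullet> (z \<bullet> x) = half \<odot> (z \<bullet> x)"
    "(z \<bullet> x) \<bullet> a = half \<odot> (z \<bullet> x)"
    "h \<bullet> (h \<bullet> x) = (half * B h x) \<odot> h - half \<odot> (z \<bullet> x)"
    "z \<bullet> (h \<bullet> x) = (half * half * B h x) \<odot> z"
    "h \<bullet> (z \<bullet> x) = (half * half * B h x) \<odot> z"
    "z \<bullet> (z \<bullet> x) = 0"
    using rules mult_commute by auto
  then show "(h \<bullet> x) \<bullet> a = (half * B h x) \<odot> a"
    "(h \<bullet> x) \<bullet> h = (half * B h x) \<odot> h - half \<odot> (z \<bullet> x)"
    "(h \<bullet> x) \<bullet> z = (half * half * B h x) \<odot> z"
    "(z \<bullet> x) \<bullet> h = (half * half * B h x) \<odot> z" "(z \<bullet> x) \<bullet> z = 0"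
    using mult_commute by metis+
  show "B a x = 0" "B z x = 0" using axis_form_half[OF a x] E0_orthogonal_Eh[OF z x] by auto
qed

lemmas ground_products = aa ha za z_z h_h z_h h_z forms

text \<open>The tables leave only the first and third powers of \<open>s\<close>. Every term of the
  cubic coefficient involves \<open>z\<close>; the linear one measures the failure of the Leibniz
  rule for multiplication by \<open>h\<close> on \<open>E0 a\<close>.\<close>

lemma odd_defect_00:
  assumes u: "u \<in> E0 a" and v: "v \<in> E0 a"
  shows "odd_defect s u v = (8 * s) \<odot> (
      (s * s) \<odot> (B z (u \<bullet> v) \<odot> h - 4 \<odot> ((h \<bullet> u) \<bullet> (z \<bullet> v) + (z \<bullet> u) \<bullet> (h \<bullet> v))
        + B z v \<odot> (h \<bullet> u) + B z u \<odot> (h \<bullet> v))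
     - (h \<bullet> (u \<bullet> v) - (h \<bullet> u) \<bullet> v - u \<bullet> (h \<bullet> v)))" (is "?l = ?r")
proof (rule vector_eqI)
  fix f assume f: "Vector_Spaces.linear sc ((*) :: 'f \<Rightarrow> 'f \<Rightarrow> 'f) f"
  note uv = fusion_00[OF a u v]
  show "f ?l = f ?r"
    unfolding odd_defect_def miyamoto_def axis_curve_def bilinear E0_products[OF u] E0_products[OF v]
      E0_products(1,2,17,18)[OF uv] ground_products functional_simps[OF f]
    using two_half by algebra
qed

text \<open>The linear coefficient is a Leibniz rule with changed sign: up to a multiple of
  \<open>a\<close>, the commutator acts as \<open>half\<close> times multiplication by
  \<open>h\<close> on \<open>E0 a\<close> and as minus that on \<open>Eh a\<close>.\<close>

lemma odd_defect_h0:
  assumes x: "x \<in> Eh a" and u: "u \<in> E0 a"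
  shows "odd_defect s x u = (8 * s) \<odot> (
      (s * s) \<odot> (B h (x \<bullet> u) \<odot> z - 4 \<odot> ((h \<bullet> x) \<bullet> (z \<bullet> u) + (z \<bullet> x) \<bullet> (h \<bullet> u))
        + B h x \<odot> (z \<bullet> u) + B z u \<odot> (h \<bullet> x))
     - (h \<bullet> (x \<bullet> u) - B h (x \<bullet> u) \<odot> a - (h \<bullet> x) \<bullet> u + x \<bullet> (h \<bullet> u)))" (is "?l = ?r")
proof (rule vector_eqI)
  fix f assume f: "Vector_Spaces.linear sc ((*) :: 'f \<Rightarrow> 'f \<Rightarrow> 'f) f"
  note xu = fusion_h0[OF a u x]
  show "f ?l = f ?r"
    unfolding odd_defect_def miyamoto_def axis_curve_def bilinear E0_products[OF u] Eh_products[OF x]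
      Eh_products(1,2,17,18)[OF xu] ground_products functional_simps[OF f]
    using two_half by algebra
qed

lemma odd_defect_hh:
  assumes x: "x \<in> Eh a" and y: "y \<in> Eh a"
  shows "odd_defect s x y = (8 * s) \<odot> (
      (s * s) \<odot> (B z (x \<bullet> y) \<odot> h - 4 \<odot> ((h \<bullet> x) \<bullet> (z \<bullet> y) + (z \<bullet> x) \<bullet> (h \<bullet> y))
        + B h x \<odot> (z \<bullet> y) + B h y \<odot> (z \<bullet> x))
     - (h \<bullet> (x \<bullet> y) + (h \<bullet> x) \<bullet> y + (h \<bullet> y) \<bullet> x - (half * B h y) \<odot> x - (half * B h x) \<odot> y
         - B a (x \<bullet> y) \<odot> h))" (is "?l = ?r")
proof (rule vector_eqI)
  fix f assume f: "Vector_Spaces.linear sc ((*) :: 'f \<Rightarrow> 'f \<Rightarrow> 'f) f"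
  \<comment> \<open>The product lies in the span of \<open>a\<close> and \<open>E0 a\<close>, which
    is orthogonal to \<open>h\<close>.\<close>
  have hxy: "B h (x \<bullet> y) = 0"
    unfolding half_prod[of x y a] bilinear forms E0_orthogonal_Eh[OF half_prod_zero_in_E0[OF a x y] h]
    by simp
  show "f ?l = f ?r"
    unfolding odd_defect_def miyamoto_def axis_curve_def bilinear Eh_products[OF x] Eh_products[OF y]
      hxy mult_commute[of "h \<bullet> y" x] ground_products functional_simps[OF f]
    using two_half by algebra
qed

lemma three_neq_0: "CHAR('f) \<noteq> 3 \<Longrightarrow> (3::'f) \<noteq> 0"
proof
  assume "CHAR('f) \<noteq> 3" "(3::'f) = 0"
  then have "of_nat 3 = (0::'f)" by simp
  then have "CHAR('f) dvd 3" by (simp only: of_nat_eq_0_iff_char_dvd)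
  moreover have "prime (3::nat)" by simp
  ultimately have "CHAR('f) = 1 \<or> CHAR('f) = 3" by (metis prime_nat_iff)
  then show False using \<open>CHAR('f) \<noteq> 3\<close> by simp
qed

lemma powers_of_two_neq_0: "(8::'f) \<noteq> 0" "(16::'f) \<noteq> 0"
proof -
  have "(8::'f) = 2 * 2 * 2" "(16::'f) = 2 * 2 * 2 * 2" by simp_all
  then show "(8::'f) \<noteq> 0" "(16::'f) \<noteq> 0" using two_neq_0 by (metis mult_eq_0_iff)+
qed

text \<open>The factor \<open>8 * s\<close> is 8 or 16, hence invertible. Thus \<open>R = L\<close>
  from \<open>s = 1\<close> and \<open>4 \<odot> R = L\<close> from \<open>s = 2\<close>; if
  \<open>z = 0\<close>, the first equation is enough.\<close>

lemma linear_coefficient_vanishes: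
  assumes D: "\<And>s. odd_defect s x y = (8 * s) \<odot> ((s * s) \<odot> R - L)"
    and R: "z = 0 \<Longrightarrow> R = 0"
    and z: "z = 0 \<or> CHAR('f) \<noteq> 3"
  shows "L = 0"
proof -
  have 1: "R = L" using D[of 1] odd_defect[of 1 x y] powers_of_two_neq_0 by simp
  have "4 \<odot> R = L" using D[of 2] odd_defect[of 2 x y] powers_of_two_neq_0 by simp
  then have "3 \<odot> L = 0" using 1 scale_left_diff_distrib[of 4 1 L] by simp
  then show ?thesis using z R three_neq_0 1 by auto
qed

section \<open>Product identities and the derivation property\<close>

context
  assumes char: "z = 0 \<or> CHAR('f) \<noteq> 3"
begin

lemma product_00:
  assumes u: "u \<in> E0 a" and v: "v \<in> E0 a"
  shows "h \<bullet> (u \<bullet> v) = (h \<bullet> u) \<bullet> v + u \<bullet> (h \<bullet> v)"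
  using linear_coefficient_vanishes[OF odd_defect_00[OF u v] _ char]
  by (simp add: bilinear algebra_simps)

text \<open>The unprojected form of the second identity for \<open>h\<close>, with its component
  along \<open>a\<close> explicit.\<close>

lemma product_h0:
  assumes x: "x \<in> Eh a" and u: "u \<in> E0 a"
  shows "h \<bullet> (x \<bullet> u) = B h (x \<bullet> u) \<odot> a + (h \<bullet> x) \<bullet> u - x \<bullet> (h \<bullet> u)"
  using linear_coefficient_vanishes[OF odd_defect_h0[OF x u] _ char]
  by (simp add: bilinear algebra_simps)

lemma product_hh:
  assumes x: "x \<in> Eh a" and y: "y \<in> Eh a"
  shows "h \<bullet> (x \<bullet> y) + (h \<bullet> x) \<bullet> y + (h \<bullet> y) \<bullet> x
    = (half * B h y) \<odot> x + (half * B h x) \<odot> y + B a (x \<bullet> y) \<odot> h"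
  using linear_coefficient_vanishes[OF odd_defect_hh[OF x y] _ char]
  by (simp add: bilinear algebra_simps)

text \<open>Multiplication by \<open>a\<close> commutes with itself and with multiplication by
  \<open>z\<close>, so only the summand \<open>h\<close> of \<open>b\<close> contributes.\<close>

lemma commutator_eq: "commutator (m a) (m b) x = a \<bullet> (h \<bullet> x) - h \<bullet> (a \<bullet> x)"
  using E0_mult_commutes_axis[OF a z, of x] by (simp add: commutator_def b_eq bilinear)

text \<open>By bilinearity the Leibniz rule is needed only for factors that are \<open>a\<close> or
  lie in \<open>E0 a\<close> or \<open>Eh a\<close>. The cases without \<open>a\<close> are the
  three product identities.\<close>

lemma commutator_derivation: "is_derivation sc m (commutator (m a) (m b))"
proof -
  let ?D = "commutator (m a) (m b)"
  have lin: "Vector_Spaces.linear sc sc ?D"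
    by unfold_locales
      (simp_all add: commutator_eq bilinear algebra_simps scale_right_distrib scale_right_diff_distrib)
  interpret D: Vector_Spaces.linear sc sc ?D by (rule lin)
  \<comment> \<open>A quarter of \<open>h\<close> from \<open>a \<bullet> (h \<bullet> a)\<close>
    minus a half of \<open>h\<close> from \<open>h \<bullet> (a \<bullet> a)\<close>.\<close>
  have Da: "?D a = - ((half * half) \<odot> h)"
  proof (rule vector_eqI)
    fix f assume f: "Vector_Spaces.linear sc ((*) :: 'f \<Rightarrow> 'f \<Rightarrow> 'f) f"
    show "f (?D a) = f (- ((half * half) \<odot> h))"
      unfolding commutator_eq bilinear aa ha functional_simps[OF f] using two_half by algebra
  qed
  have D0: "?D u = half \<odot> (h \<bullet> u)" if u: "u \<in> E0 a" for u
    unfolding commutator_eq by (simp add: E0_products[OF u] bilinear)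
  have Dh: "?D x = (half * B h x) \<odot> a - half \<odot> (h \<bullet> x)" if x: "x \<in> Eh a" for x
    unfolding commutator_eq by (simp add: Eh_products[OF x] bilinear)
  have D00: "?D (u \<bullet> v) = u \<bullet> ?D v + ?D u \<bullet> v" if u: "u \<in> E0 a" and v: "v \<in> E0 a" for u v
    unfolding D0[OF u] D0[OF v] D0[OF fusion_00[OF a u v]] product_00[OF u v]
    by (simp add: bilinear scale_right_distrib)
  have Dh0: "?D (x \<bullet> u) = x \<bullet> ?D u + ?D x \<bullet> u" if x: "x \<in> Eh a" and u: "u \<in> E0 a" for x u
  proof (rule vector_eqI)
    fix f assume f: "Vector_Spaces.linear sc ((*) :: 'f \<Rightarrow> 'f \<Rightarrow> 'f) f"
    show "f (?D (x \<bullet> u)) = f (x \<bullet> ?D u + ?D x \<bullet> u)"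
      unfolding D0[OF u] Dh[OF x] Dh[OF fusion_h0[OF a u x]] product_h0[OF x u] bilinear
        E0_products(1)[OF u] functional_simps[OF f]
      by algebra
  qed
  have Dhh: "?D (x \<bullet> y) = x \<bullet> ?D y + ?D x \<bullet> y" if x: "x \<in> Eh a" and y: "y \<in> Eh a" for x y
  proof (rule vector_eqI)
    fix f assume f: "Vector_Spaces.linear sc ((*) :: 'f \<Rightarrow> 'f \<Rightarrow> 'f) f"
    \<comment> \<open>This vector is 0 by \<open>product_hh\<close>; adding half of it turns the
      claim into a formal identity.\<close>
    let ?E = "h \<bullet> (x \<bullet> y) + (h \<bullet> x) \<bullet> y + (h \<bullet> y) \<bullet> x
      - ((half * B h y) \<odot> x + (half * B h x) \<odot> y + B a (x \<bullet> y) \<odot> h)"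
    have hp: "h \<bullet> half_prod_zero a x y = h \<bullet> (x \<bullet> y) - (half * (half * B x y)) \<odot> h"
      by (simp add: half_prod_zero_def bilinear ha)
    \<comment> \<open>The product has components along \<open>a\<close> and in \<open>E0 a\<close>,
      where the commutator is already computed.\<close>
    have D: "?D (x \<bullet> y) = (half * B x y) \<odot> ?D a + ?D (half_prod_zero a x y)"
      unfolding D.add[symmetric] D.scale[symmetric] half_prod[symmetric] ..
    have axy: "B a (x \<bullet> y) = half * B x y"
      using form_assoc[of a x y] by (simp add: Eh_products[OF x] bilinear)
    have "f (?D (x \<bullet> y)) = f (x \<bullet> ?D y + ?D x \<bullet> y + half \<odot> ?E)"
      unfolding D Da D0[OF half_prod_zero_in_E0[OF a x y]] hp Dh[OF x] Dh[OF y] bilinear axy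
        Eh_products(1,2)[OF x] Eh_products(1,2)[OF y] mult_commute[of "h \<bullet> y" x] functional_simps[OF f]
      using two_half by algebra
    then show "f (?D (x \<bullet> y)) = f (x \<bullet> ?D y + ?D x \<bullet> y)"
      using product_hh[OF x y] by simp
  qed
  have Daa: "?D (a \<bullet> a) = a \<bullet> ?D a + ?D a \<bullet> a"
  proof (rule vector_eqI)
    fix f assume f: "Vector_Spaces.linear sc ((*) :: 'f \<Rightarrow> 'f \<Rightarrow> 'f) f"
    show "f (?D (a \<bullet> a)) = f (a \<bullet> ?D a + ?D a \<bullet> a)"
      unfolding aa Da bilinear ha functional_simps[OF f] using two_half by algebra
  qed
  have Da0: "?D (a \<bullet> u) = a \<bullet> ?D u + ?D a \<bullet> u" if u: "u \<in> E0 a" for u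
    unfolding D0[OF u] Da by (simp add: E0_products[OF u] bilinear D.zero)
  have Dah: "?D (a \<bullet> x) = a \<bullet> ?D x + ?D a \<bullet> x" if x: "x \<in> Eh a" for x
  proof (rule vector_eqI)
    fix f assume f: "Vector_Spaces.linear sc ((*) :: 'f \<Rightarrow> 'f \<Rightarrow> 'f) f"
    show "f (?D (a \<bullet> x)) = f (a \<bullet> ?D x + ?D a \<bullet> x)"
      unfolding Eh_products(1)[OF x] D.scale Dh[OF x] Da bilinear aa Eh_products(5)[OF x]
        functional_simps[OF f] using two_half by algebra
  qed
  have comm: "?D (y \<bullet> x) = y \<bullet> ?D x + ?D y \<bullet> x" if "?D (x \<bullet> y) = x \<bullet> ?D y + ?D x \<bullet> y" for x y
    using that by (simp add: mult_commute[of y] mult_commute[of "?D y"] add.commute)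
  have "?D (x \<bullet> y) = x \<bullet> ?D y + ?D x \<bullet> y" for x y
  proof (rule vector_eqI)
    fix f assume f: "Vector_Spaces.linear sc ((*) :: 'f \<Rightarrow> 'f \<Rightarrow> 'f) f"
    obtain s u w where x: "u \<in> E0 a" "w \<in> Eh a" "x = s \<odot> a + u + w"
      using axis_cases[OF a] .
    obtain t v r where y: "v \<in> E0 a" "r \<in> Eh a" "y = t \<odot> a + v + r"
      using axis_cases[OF a] .
    note cases = Daa D00[OF x(1) y(1)] Dh0[OF x(2) y(1)] Dhh[OF x(2) y(2)] comm[OF Dh0[OF y(2) x(1)]]
      Da0[OF y(1)] Dah[OF y(2)] comm[OF Da0[OF x(1)]] comm[OF Dah[OF x(2)]]
    show "f (?D (x \<bullet> y)) = f (x \<bullet> ?D y + ?D x \<bullet> y)"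
      unfolding x(3) y(3) bilinear D.add D.scale cases functional_simps[OF f] by algebra
  qed
  with lin show ?thesis by (simp add: is_derivation_def)
qed

end

end

section \<open>Translation to the components of \<open>b\<close>\<close>

theorem theorem1p6:
  fixes scale :: "'f::field \<Rightarrow> 'a::ab_group_add \<Rightarrow> 'a" (infixr "\<odot>" 75)
    and mult :: "'a \<Rightarrow> 'a \<Rightarrow> 'a" (infixl "\<bullet>" 70)
    and form :: "'a \<Rightarrow> 'a \<Rightarrow> 'f"
    and a b :: 'a
  assumes "frobenius_algebra scale mult form"
    and "is_axis scale mult form a"
    and "is_axis scale mult form b"
    and "form a b = 1"
  shows "(comp_zero scale mult form a b = 0 \<longrightarrow>
            is_derivation scale mult (commutator (mult a) (mult b))) \<and>
         (CHAR('f) \<noteq> 3 \<longrightarrow>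
            (\<forall>x \<in> eigenspace scale mult a (1/2). \<forall>y \<in> eigenspace scale mult a (1/2).
               comp_half scale mult form a b \<bullet> (x \<bullet> y)
               + (comp_half scale mult form a b \<bullet> x) \<bullet> y
               + (comp_half scale mult form a b \<bullet> y) \<bullet> x
               = (1/2 * form b y) \<odot> x + (1/2 * form b x) \<odot> y
                 + form a (x \<bullet> y) \<odot> comp_half scale mult form a b) \<and>
            (\<forall>x \<in> eigenspace scale mult a (1/2). \<forall>y \<in> eigenspace scale mult a 0.
               comp_zero scale mult form a (comp_half scale mult form a b \<bullet> (x \<bullet> y))
               = (comp_half scale mult form a b \<bullet> x) \<bullet> y
                 - comp_zero scale mult form a ((comp_half scale mult form a b \<bullet> y) \<bullet> x)) \<and>
            is_derivation scale mult (commutator (mult a) (mult b)))"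
proof -
  interpret frobenius_algebra scale mult form by (rule assms)
  define h where "h = comp_half scale mult form a b"
  define z where "z = comp_zero scale mult form a b"
  note dec = axis_decomposition[OF assms(2)]
  interpret axis_pair scale mult form a b z h
    using assms dec[of b] by unfold_locales (simp_all add: h_def z_def)
  \<comment> \<open>By uniqueness of components, with half component 0, the definite description
    becomes an explicit formula.\<close>
  have comp: "comp_zero scale mult form a (x \<bullet> y) = half_prod_zero a x y"
    if x: "x \<in> Eh a" and y: "y \<in> Eh a" for x y
  proof -
    have "x \<bullet> y = (half * form x y) \<odot> a + half_prod_zero a x y + 0"
      by (simp add: half_prod_zero_def)
    then show ?thesis
      using dec(4)[OF half_prod_zero_in_E0[OF a x y] eigenspace_closed(5)[OF x x]] by metis
  qed
  have part2: "half_prod_zero a h (x \<bullet> u) = (h \<bullet> x) \<bullet> u - half_prod_zero a (h \<bullet> u) x"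
    if char: "CHAR('f) \<noteq> 3" and x: "x \<in> Eh a" and u: "u \<in> E0 a" for x u
  proof -
    \<comment> \<open>Hence both projections remove the same multiple of \<open>a\<close>, and
      together these account for the \<open>a\<close> term of \<open>product_h0\<close>.\<close>
    have eq: "form (h \<bullet> u) x = form h (x \<bullet> u)"
      using form_assoc[of h u x] mult_commute[of u x] by simp
    show ?thesis
    proof (rule vector_eqI)
      fix f assume f: "Vector_Spaces.linear scale ((*) :: 'f \<Rightarrow> 'f \<Rightarrow> 'f) f"
      show "f (half_prod_zero a h (x \<bullet> u)) = f ((h \<bullet> x) \<bullet> u - half_prod_zero a (h \<bullet> u) x)"
        unfolding half_prod_zero_def product_h0[OF disjI2[OF char] x u] eq
          mult_commute[of "h \<bullet> u" x] functional_simps[OF f]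
        using two_half by algebra
    qed
  qed
  have "is_derivation scale mult (commutator (mult a) (mult b))" if "z = 0 \<or> CHAR('f) \<noteq> 3"
    using that by (rule commutator_derivation)
  moreover have "h \<bullet> (x \<bullet> y) + (h \<bullet> x) \<bullet> y + (h \<bullet> y) \<bullet> x
      = (1/2 * form b y) \<odot> x + (1/2 * form b x) \<odot> y + form a (x \<bullet> y) \<odot> h"
    if "CHAR('f) \<noteq> 3" "x \<in> Eh a" "y \<in> Eh a" for x y
    using product_hh[OF disjI2] that by (simp add: form_b_Eh half_def)
  moreover have "comp_zero scale mult form a (h \<bullet> (x \<bullet> u))
      = (h \<bullet> x) \<bullet> u - comp_zero scale mult form a ((h \<bullet> u) \<bullet> x)"
    if "CHAR('f) \<noteq> 3" and x: "x \<in> Eh a" and u: "u \<in> E0 a" for x u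
    using part2[OF that] comp[OF h fusion_h0[OF a u x]] comp[OF fusion_h0[OF a u h] x] by simp
  ultimately show ?thesis unfolding h_def[symmetric] z_def[symmetric] by blast
qed

end
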